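(* Fix $\alpha\in[0,1]$. Suppose $Z=(Z_1,\dots,Z_{n+1})\in\mathcal{Z}^{n+1}$, with $Z_i=(X_i,Y_i)$, has density $f$ with respect to an exchangeable base measure, with $f$ satisfying $$\frac{f(z_\sigma)}{f(z)}=\frac{f_X(x_{\sigma(1)},\dots,x_{\sigma(n+1)})}{f_X(x_1,\dots,x_{n+1})}$$ for all $z=((x_1,y_1),\dots,(x_{n+1},y_{n+1}))$ and all permutations $\sigma\in\mathcal{S}_{n+1}$, where $f_X$ is the corresponding density of $X=(X_1,\dots,X_{n+1})$. Let $g_X$ be an arbitrary proposal density on $\mathcal{X}^{n+1}$ such that $f_X,g_X$ are absolutely continuous with respect to each other. Then for any integer $M\ge1$, the importance sampling approximation to the generalized weighted conformal prediction set, $$\mathcal{C}(X_{n+1})=\bigg\{y\in\mathcal{Y}:S^y_{\mathrm{id}}\le\mathrm{Quantile}_{1-\alpha}\bigg(\frac{\sum_{m=0}^M\frac{f_X(X_{\sigma_m})/f_X(X)}{g_X(X_{\sigma_m})/g_X(X)}\,\delta_{S^y_{\sigma_m}}}{\sum_{m=0}^M\frac{f_X(X_{\sigma_m})/f_X(X)}{g_X(X_{\sigma_m})/g_X(X)}}\bigg)\bigg\},$$ satisfies $\mathbb{P}\{Y_{n+1}\in\mathcal{C}(X_{n+1})\}\ge1-\alpha$.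
   Context: $\mathcal{X},\mathcal{Y}$ are measurable spaces, $\mathcal{Z}=\mathcal{X}\times\mathcal{Y}$, $n\ge1$, and all functions are measurable. $\mathcal{S}_{n+1}$ is the set of permutations of $\{1,\dots,n+1\}$ and $\mathrm{id}$ is the identity permutation. For a vector $v$ of length $n+1$ and $\sigma\in\mathcal{S}_{n+1}$, $v_\sigma=(v_{\sigma(1)},\dots,v_{\sigma(n+1)})$. An exchangeable base measure is one that is invariant under all maps $v\mapsto v_\sigma$. Densities are taken with respect to exchangeable base measures, with $f_X$ and $g_X$ taken with respect to the same base measure on $\mathcal{X}^{n+1}$. The density $f$ is assumed strictly positive, so that the ratios are well-defined. (The displayed identity for $f$ holds, for example, when $X\sim P_X$ is arbitrary and, given $X$, the $Y_i$ are independent with $Y_i$ drawn from a common conditional distribution $P_{Y\mid X}$ at $X_i$.) The permutations $\sigma_1,\dots,\sigma_M$ are sampled, conditionally on the data $Z$, i.i.d. from the distribution on $\mathcal{S}_{n+1}$ (depending only on $X$) that places probability $g_X(X_\sigma)/\sum_{\sigma'\in\mathcal{S}_{n+1}}g_X(X_{\sigma'})$ on each $\sigma\in\mathcal{S}_{n+1}$; set $\sigma_0=\mathrm{id}$. A score function $\mathsf{s}:\mathcal{Z}\times\mathcal{Z}^{n+1}\to\mathbb{R}$ is fixed, not necessarily symmetric in its second argument. For $y\in\mathcal{Y}$, let $Z^y=(Z_1,\dots,Z_n,(X_{n+1},y))$ and $S^y_\sigma=\mathsf{s}(Z^y_{\sigma(n+1)},Z^y_\sigma)$ for $\sigma\in\mathcal{S}_{n+1}$.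 $\delta_v$ is the point mass at $v$, and $\mathrm{Quantile}_\tau(P)=\inf\{x\in\mathbb{R}:\mathbb{P}_{V\sim P}\{V\le x\}\ge\tau\}$. The probability in the claim is over the data and the sampled permutations. *)

theory Defs
  imports "HOL-Probability.Probability" "HOL-Combinatorics.Permutations"
begin

text \<open>
  A vector of length \<open>n + 1\<close> with entries in a measurable space \<open>A\<close> is an (extensional) element of
  \<open>space (vec_space n A)\<close>. For such \<open>v\<close> and \<open>\<sigma> permutes {1..n + 1}\<close>, the permuted vector with entries
  \<open>v (\<sigma> 1), \<dots>, v (\<sigma> (n + 1))\<close> is \<open>v \<circ> \<sigma>\<close>, which is again extensional because \<open>\<sigma>\<close> fixes every index
  outside \<open>{1..n + 1}\<close>.
\<close>

definition vec_space :: "nat \<Rightarrow> 'a measure \<Rightarrow> (nat \<Rightarrow> 'a) measure" where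
  "vec_space n A = (\<Pi>\<^sub>M i\<in>{1..n + 1}. A)"

definition perms :: "nat \<Rightarrow> (nat \<Rightarrow> nat) set" where
  "perms n = {\<sigma>. \<sigma> permutes {1..n + 1}}"

definition exchangeable_measure :: "nat \<Rightarrow> 'a measure \<Rightarrow> (nat \<Rightarrow> 'a) measure \<Rightarrow> bool" where
  "exchangeable_measure n A \<mu> \<longleftrightarrow>
     sets \<mu> = sets (vec_space n A) \<and> (\<forall>\<sigma>\<in>perms n. distr \<mu> \<mu> (\<lambda>v. v \<circ> \<sigma>) = \<mu>)"

definition x_part :: "nat \<Rightarrow> (nat \<Rightarrow> 'x \<times> 'y) \<Rightarrow> nat \<Rightarrow> 'x" where
  "x_part n z = (\<lambda>i\<in>{1..n + 1}. fst (z i))"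

definition proposal_prob :: "nat \<Rightarrow> ((nat \<Rightarrow> 'x) \<Rightarrow> real) \<Rightarrow> (nat \<Rightarrow> 'x) \<Rightarrow> (nat \<Rightarrow> nat) \<Rightarrow> real" where
  "proposal_prob n g x \<sigma> = g (x \<circ> \<sigma>) / (\<Sum>\<sigma>'\<in>perms n. g (x \<circ> \<sigma>'))"

text \<open>
  Conditionally on the random variable \<open>Z\<close> (with values in \<open>N\<close>), the random variables \<open>W m\<close>, \<open>m \<in> J\<close>,
  with values in the finite set \<open>S\<close>, are i.i.d. with conditional probability mass function \<open>q (Z \<omega>)\<close>:
  almost surely, \<open>P(\<forall>m\<in>J. W m = w m | Z) = \<Prod>m\<in>J. q Z (w m)\<close> for each \<open>w\<close>.
\<close>

definition cond_iid_given ::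
  "'w measure \<Rightarrow> 'z measure \<Rightarrow> ('w \<Rightarrow> 'z) \<Rightarrow> 'p set \<Rightarrow> ('z \<Rightarrow> 'p \<Rightarrow> real) \<Rightarrow> 'm set \<Rightarrow> ('m \<Rightarrow> 'w \<Rightarrow> 'p) \<Rightarrow> bool"
  where
  "cond_iid_given P N Z S q J W \<longleftrightarrow>
     (\<forall>m\<in>J. W m \<in> measurable P (count_space S)) \<and>
     (\<forall>w\<in>J \<rightarrow> S. AE \<omega> in P.
        real_cond_exp P (vimage_algebra (space P) Z N)
          (indicator {\<omega>\<in>space P. \<forall>m\<in>J. W m \<omega> = w m}) \<omega> = (\<Prod>m\<in>J. q (Z \<omega>) (w m)))"

text \<open>
  The infimum is taken in the extended reals, so that the quantile at level \<open>0\<close> is \<open>-\<infinity>\<close>.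
\<close>

definition quantile :: "real \<Rightarrow> real measure \<Rightarrow> ereal" where
  "quantile \<tau> D = Inf {ereal x |x. measure D {..x} \<ge> \<tau>}"

text \<open>
  \<open>(\<Sum>m\<in>J. w m * \<delta>(v m)) / (\<Sum>m\<in>J. w m)\<close>, as the law of \<open>v m\<close> for an index \<open>m\<close> drawn with
  probability proportional to \<open>w m\<close>.
\<close>

definition weighted_dist :: "'m set \<Rightarrow> ('m \<Rightarrow> real) \<Rightarrow> ('m \<Rightarrow> real) \<Rightarrow> real measure" where
  "weighted_dist J w v = distr (point_measure J (\<lambda>m. ennreal (w m / (\<Sum>k\<in>J. w k)))) borel v"

definition impute :: "nat \<Rightarrow> (nat \<Rightarrow> 'x \<times> 'y) \<Rightarrow> 'y \<Rightarrow> nat \<Rightarrow> 'x \<times> 'y" where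
  "impute n z y = z(n + 1 := (fst (z (n + 1)), y))"

definition perm_score ::
  "nat \<Rightarrow> (('x \<times> 'y) \<times> (nat \<Rightarrow> 'x \<times> 'y) \<Rightarrow> real) \<Rightarrow> (nat \<Rightarrow> 'x \<times> 'y) \<Rightarrow> 'y \<Rightarrow> (nat \<Rightarrow> nat) \<Rightarrow> real" where
  "perm_score n s z y \<sigma> = s (impute n z y (\<sigma> (n + 1)), impute n z y \<circ> \<sigma>)"

definition importance_weight ::
  "((nat \<Rightarrow> 'x) \<Rightarrow> real) \<Rightarrow> ((nat \<Rightarrow> 'x) \<Rightarrow> real) \<Rightarrow> (nat \<Rightarrow> 'x) \<Rightarrow> (nat \<Rightarrow> nat) \<Rightarrow> real" where
  "importance_weight f g x \<sigma> = (f (x \<circ> \<sigma>) / f x) / (g (x \<circ> \<sigma>) / g x)"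

text \<open>
  The prediction set computed from data \<open>z\<close> and permutations \<open>\<sigma> 0, \<dots>, \<sigma> M\<close>. It does not depend on
  the response of the last data point, which enters neither \<open>impute\<close> nor \<open>x_part\<close>.
\<close>

definition prediction_set ::
  "'y measure \<Rightarrow> nat \<Rightarrow> (('x \<times> 'y) \<times> (nat \<Rightarrow> 'x \<times> 'y) \<Rightarrow> real) \<Rightarrow>
   ((nat \<Rightarrow> 'x) \<Rightarrow> real) \<Rightarrow> ((nat \<Rightarrow> 'x) \<Rightarrow> real) \<Rightarrow> real \<Rightarrow> nat \<Rightarrow>
   (nat \<Rightarrow> 'x \<times> 'y) \<Rightarrow> (nat \<Rightarrow> nat \<Rightarrow> nat) \<Rightarrow> 'y set" where
  "prediction_set MY n s f\<^sub>X g\<^sub>X \<alpha> M z \<sigma> =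
     {y\<in>space MY. ereal (perm_score n s z y id) \<le>
        quantile (1 - \<alpha>)
          (weighted_dist {0..M}
             (\<lambda>m. importance_weight f\<^sub>X g\<^sub>X (x_part n z) (\<sigma> m))
             (\<lambda>m. perm_score n s z y (\<sigma> m)))}"

end

theory Submission
  imports Defs
begin

text \<open>
  Coverage holds even conditionally on the unordered data, by exchangeability of the \<open>M + 1\<close>
  candidates once the importance weights are accounted for. Put \<open>h z = f z / g\<^sub>X x\<close>, where \<open>x\<close> is the
  covariate part of \<open>z\<close>. The hypothesis on \<open>f\<close> turns the importance weight of \<open>\<sigma>\<close> into
  \<open>h (z \<circ> \<sigma>) / h z\<close>. The true response is not covered iff the score of \<open>z\<close> itself lies strictly above
  the \<open>1 - \<alpha>\<close> quantile of the scores of the candidates \<open>z \<circ> \<sigma> m\<close>, weighted by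
  \<open>h (z \<circ> \<sigma> m)\<close> (\<open>le_quantile_weighted_dist_iff\<close>).

  The joint density of the data and the sampled permutations is
  \<open>f z * (\<Prod>m\<in>{1..M}. g\<^sub>X (x \<circ> \<sigma> m)) / G\<^sup>M\<close>, where \<open>G\<close> is the sum of \<open>g\<^sub>X\<close> over the orbit of \<open>x\<close>
  (\<open>emeasure_data_and_perms\<close>). Since \<open>f = h * g\<^sub>X\<close> and \<open>\<sigma> 0 = id\<close>, it equals
  \<open>h (z \<circ> \<sigma> 0) * (\<Prod>m\<in>{0..M}. g\<^sub>X (x \<circ> \<sigma> m)) / G\<^sup>M\<close>, which is symmetric in \<open>0, \<dots>, M\<close> except for the
  first factor. As the base measure is exchangeable, the constraint \<open>\<sigma> 0 = id\<close> may be replaced by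
  a free choice of \<open>\<sigma> 0\<close>, at the price of the factor \<open>(n + 1)!\<close>
  (\<open>nn_integral_sum_PiE_perms\<close>). The sum over all tuples is then invariant under exchanging two
  positions, so position \<open>0\<close> may be replaced by the average over all positions, which
  reduces the claim to the fact that the candidates above the weighted quantile carry at
  most the fraction \<open>\<alpha>\<close> of the total weight (\<open>sum_above_quantile_le\<close>, \<open>sum_PiE_above_quantile_le\<close>).
\<close>

section \<open>Quantiles\<close>

lemma measure_weighted_dist_atMost:
  assumes "finite J" and w: "\<And>m. m \<in> J \<Longrightarrow> 0 \<le> w m"
  shows "measure (weighted_dist J w v) {..x} = (\<Sum>m | m \<in> J \<and> v m \<le> x. w m) / (\<Sum>m\<in>J. w m)"
proof -
  let ?p = "\<lambda>m. w m / (\<Sum>k\<in>J. w k)"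
  have "emeasure (weighted_dist J w v) {..x} =
      emeasure (point_measure J (\<lambda>m. ennreal (?p m))) {m \<in> J. v m \<le> x}"
    unfolding weighted_dist_def
    by (subst emeasure_distr) (auto simp: space_point_measure intro!: arg_cong2[where f=emeasure])
  also have "\<dots> = (\<Sum>m | m \<in> J \<and> v m \<le> x. ennreal (?p m))"
    using assms by (subst emeasure_point_measure_finite) auto
  also have "\<dots> = ennreal (\<Sum>m | m \<in> J \<and> v m \<le> x. ?p m)"
    using w by (intro sum_ennreal) (auto intro!: divide_nonneg_nonneg sum_nonneg)
  moreover have "0 \<le> (\<Sum>m | m \<in> J \<and> v m \<le> x. ?p m)"
    using w by (intro sum_nonneg divide_nonneg_nonneg) auto
  ultimately show ?thesis
    by (simp add: measure_def sum_divide_distrib)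
qed

text \<open>
  The infimum in \<open>quantile\<close> is replaced by the mass strictly below \<open>t\<close>, which is visibly measurable
  in the data. For \<open>\<tau> > 0\<close>, mass \<open>\<tau>\<close> strictly below \<open>t\<close> is already reached at the largest atom below
  \<open>t\<close>. The equivalence includes total weight \<open>0\<close>, where the quotient is \<open>0\<close> and the quantile
  is \<open>\<infinity>\<close>.
\<close>

lemma le_quantile_weighted_dist_iff:
  assumes "finite J" and w: "\<And>m. m \<in> J \<Longrightarrow> 0 \<le> w m" and "0 < \<tau>"
  shows "ereal t \<le> quantile \<tau> (weighted_dist J w v) \<longleftrightarrow>
    (\<Sum>m | m \<in> J \<and> v m < t. w m) / (\<Sum>m\<in>J. w m) < \<tau>"
proof -
  let ?D = "\<lambda>x. (\<Sum>m | m \<in> J \<and> v m \<le> x. w m) / (\<Sum>m\<in>J. w m)"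
  let ?L = "(\<Sum>m | m \<in> J \<and> v m < t. w m) / (\<Sum>m\<in>J. w m)"
  have "ereal t \<le> quantile \<tau> (weighted_dist J w v) \<longleftrightarrow> (\<forall>x. \<tau> \<le> ?D x \<longrightarrow> t \<le> x)"
    unfolding quantile_def le_Inf_iff using measure_weighted_dist_atMost[OF assms(1,2)] by auto
  also have "\<dots> \<longleftrightarrow> \<not> \<tau> \<le> ?L"
  proof
    assume all: "\<forall>x. \<tau> \<le> ?D x \<longrightarrow> t \<le> x"
    show "\<not> \<tau> \<le> ?L"
    proof
      assume le: "\<tau> \<le> ?L"
      let ?A = "{m \<in> J. v m < t}"
      have ne: "?A \<noteq> {}"
      proof
        assume "?A = {}"
        then have "?L = 0" by (simp only:) simp
        with le \<open>0 < \<tau>\<close> show False by linarith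
      qed
      define x where "x = Max (v ` ?A)"
      have "x \<in> v ` ?A" unfolding x_def using ne \<open>finite J\<close> by (intro Max_in) auto
      then have "x < t" by auto
      moreover have "{m \<in> J. v m \<le> x} = ?A"
        using \<open>x < t\<close> \<open>finite J\<close> by (auto simp: x_def)
      with le have "\<tau> \<le> ?D x" by simp
      ultimately show False using all by force
    qed
  next
    assume L: "\<not> \<tau> \<le> ?L"
    show "\<forall>x. \<tau> \<le> ?D x \<longrightarrow> t \<le> x"
    proof (intro allI impI, rule ccontr)
      fix x assume "\<tau> \<le> ?D x" "\<not> t \<le> x"
      have "?D x \<le> ?L"
        using assms(1,2) \<open>\<not> t \<le> x\<close>
        by (intro divide_right_mono sum_mono2 sum_nonneg) auto
      with \<open>\<tau> \<le> ?D x\<close> L show False by linarith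
    qed
  qed
  finally show ?thesis by (simp add: not_le)
qed

section \<open>Weighted ranks\<close>

text \<open>
  For \<open>\<alpha> < 1\<close> and positive total weight, this says that the score \<open>v k\<close> lies strictly above the
  \<open>1 - \<alpha>\<close> quantile of the weighted scores. Both sides are linear in \<open>w\<close>, so a common
  positive factor of the weights does not matter.
\<close>

definition above_quantile :: "real \<Rightarrow> 'm set \<Rightarrow> ('m \<Rightarrow> real) \<Rightarrow> ('m \<Rightarrow> real) \<Rightarrow> 'm \<Rightarrow> bool" where
  "above_quantile \<alpha> J w v k \<longleftrightarrow> (1 - \<alpha>) * (\<Sum>j\<in>J. w j) \<le> (\<Sum>j | j \<in> J \<and> v j < v k. w j)"

lemma above_quantile_cong:
  assumes "\<And>j. j \<in> J \<Longrightarrow> w j = w' j" and "\<And>j. j \<in> J \<Longrightarrow> v j = v' j" and "k \<in> J"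
  shows "above_quantile \<alpha> J w v k \<longleftrightarrow> above_quantile \<alpha> J w' v' k"
proof -
  have "(\<Sum>j | j \<in> J \<and> v j < v k. w j) = (\<Sum>j | j \<in> J \<and> v' j < v' k. w' j)"
    using assms by (intro sum.cong) auto
  moreover have "(\<Sum>j\<in>J. w j) = (\<Sum>j\<in>J. w' j)" using assms by (intro sum.cong) auto
  ultimately show ?thesis by (simp add: above_quantile_def)
qed

text \<open>
  The indices above the quantile form an upper set in the order of the scores \<open>v\<close>. All of it lies at or
  above its lowest score, and the weight strictly below that score is already at least
  \<open>1 - \<alpha>\<close> of the total.
\<close>

lemma sum_above_quantile_le:
  assumes "finite J" and w: "\<And>j. j \<in> J \<Longrightarrow> 0 \<le> w j" and "0 \<le> \<alpha>"
  shows "(\<Sum>k | k \<in> J \<and> above_quantile \<alpha> J w v k. w k) \<le> \<alpha> * (\<Sum>k\<in>J. w k)"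
proof (cases "{k \<in> J. above_quantile \<alpha> J w v k} = {}")
  case True
  then show ?thesis using w \<open>0 \<le> \<alpha>\<close> by (simp only:) (auto intro!: mult_nonneg_nonneg sum_nonneg)
next
  case False
  then obtain k where k: "k \<in> J" "above_quantile \<alpha> J w v k"
    and min: "\<And>j. j \<in> J \<Longrightarrow> above_quantile \<alpha> J w v j \<Longrightarrow> v k \<le> v j"
    using ex_min_if_finite[of "v ` {k \<in> J. above_quantile \<alpha> J w v k}"] \<open>finite J\<close>
    by (fastforce simp: not_less)
  have "(\<Sum>k | k \<in> J \<and> above_quantile \<alpha> J w v k. w k) \<le> (\<Sum>j | j \<in> J \<and> \<not> v j < v k. w j)"
    using \<open>finite J\<close> w min by (intro sum_mono2) (force simp: not_less)+
  also have "\<dots> = (\<Sum>j\<in>J. w j) - (\<Sum>j | j \<in> J \<and> v j < v k. w j)"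
  proof -
    have "(\<Sum>j\<in>J. w j) = (\<Sum>j | j \<in> J \<and> v j < v k. w j) + (\<Sum>j | j \<in> J \<and> \<not> v j < v k. w j)"
      using \<open>finite J\<close> by (subst sum.union_disjoint[symmetric]) (auto intro!: sum.cong)
    then show ?thesis by simp
  qed
  also have "\<dots> \<le> \<alpha> * (\<Sum>k\<in>J. w k)"
    using k(2) by (simp add: above_quantile_def algebra_simps)
  finally show ?thesis .
qed

text \<open>
  Exchanging the positions \<open>i\<close> and \<open>k\<close> of a tuple permutes \<open>J \<rightarrow>\<^sub>E Q\<close> and keeps the product of the
  \<open>g (\<tau> m)\<close>, so both sides keep their values when \<open>i\<close> is replaced by \<open>k\<close>. Summed over all
  positions, the inequality holds tuple by tuple.
\<close>

lemma sum_PiE_above_quantile_le: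
  fixes g h t :: "'q \<Rightarrow> real"
  assumes "finite J" and "finite Q" and i: "i \<in> J" and "0 \<le> \<alpha>"
    and h: "\<And>q. q \<in> Q \<Longrightarrow> 0 \<le> h q" and g: "\<And>q. q \<in> Q \<Longrightarrow> 0 \<le> g q"
  shows "(\<Sum>\<tau>\<in>J \<rightarrow>\<^sub>E Q. h (\<tau> i) * (\<Prod>m\<in>J. g (\<tau> m)) *
            of_bool (above_quantile \<alpha> J (\<lambda>m. h (\<tau> m)) (\<lambda>m. t (\<tau> m)) i))
    \<le> \<alpha> * (\<Sum>\<tau>\<in>J \<rightarrow>\<^sub>E Q. h (\<tau> i) * (\<Prod>m\<in>J. g (\<tau> m)))"
proof -
  let ?B = "\<lambda>\<tau> k. above_quantile \<alpha> J (\<lambda>m. h (\<tau> m)) (\<lambda>m. t (\<tau> m)) k"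
  let ?R = "\<lambda>\<tau>. \<Prod>m\<in>J. g (\<tau> m)"
  define L where "L k = (\<Sum>\<tau>\<in>J \<rightarrow>\<^sub>E Q. h (\<tau> k) * ?R \<tau> * of_bool (?B \<tau> k))" for k
  define U where "U k = (\<Sum>\<tau>\<in>J \<rightarrow>\<^sub>E Q. h (\<tau> k) * ?R \<tau>)" for k
  have swap: "L k = L i \<and> U k = U i" if k: "k \<in> J" for k
  proof -
    let ?s = "Transposition.transpose i k"
    have sJ: "bij_betw ?s J J" using i k by simp
    have bij: "bij_betw (\<lambda>\<tau>. \<tau> \<circ> ?s) (J \<rightarrow>\<^sub>E Q) (J \<rightarrow>\<^sub>E Q)"
    proof (rule bij_betw_byWitness[where f' = "\<lambda>\<tau>. \<tau> \<circ> ?s"])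
      have "\<tau> \<circ> ?s \<in> J \<rightarrow>\<^sub>E Q" if "\<tau> \<in> J \<rightarrow>\<^sub>E Q" for \<tau>
        using that i k by (auto simp: PiE_iff extensional_def Transposition.transpose_def)
      then show "(\<lambda>\<tau>. \<tau> \<circ> ?s) ` (J \<rightarrow>\<^sub>E Q) \<subseteq> J \<rightarrow>\<^sub>E Q" "(\<lambda>\<tau>. \<tau> \<circ> ?s) ` (J \<rightarrow>\<^sub>E Q) \<subseteq> J \<rightarrow>\<^sub>E Q" by auto
    qed (auto simp: o_assoc[symmetric])
    have R: "?R (\<tau> \<circ> ?s) = ?R \<tau>" for \<tau>
      using prod.reindex_bij_betw[OF sJ, of "\<lambda>m. g (\<tau> m)"] by simp
    have B: "?B (\<tau> \<circ> ?s) k = ?B \<tau> i" for \<tau>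
    proof -
      have "bij_betw ?s {j \<in> J. t (\<tau> (?s j)) < t (\<tau> i)} {j \<in> J. t (\<tau> j) < t (\<tau> i)}"
        using i k by (intro bij_betw_byWitness[where f' = ?s]) (auto simp: Transposition.transpose_def)
      from sum.reindex_bij_betw[OF this, of "\<lambda>j. h (\<tau> j)"]
        sum.reindex_bij_betw[OF sJ, of "\<lambda>j. h (\<tau> j)"]
      show ?thesis by (simp add: above_quantile_def)
    qed
    have "L k = (\<Sum>\<tau>\<in>J \<rightarrow>\<^sub>E Q. h ((\<tau> \<circ> ?s) k) * ?R (\<tau> \<circ> ?s) * of_bool (?B (\<tau> \<circ> ?s) k))"
      unfolding L_def by (rule sum.reindex_bij_betw[OF bij, symmetric])
    moreover have "U k = (\<Sum>\<tau>\<in>J \<rightarrow>\<^sub>E Q. h ((\<tau> \<circ> ?s) k) * ?R (\<tau> \<circ> ?s))"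
      unfolding U_def by (rule sum.reindex_bij_betw[OF bij, symmetric])
    ultimately show ?thesis
      unfolding R B by (simp add: L_def U_def)
  qed
  have "real (card J) * L i = (\<Sum>k\<in>J. L k)" using swap by simp
  also have "\<dots> = (\<Sum>\<tau>\<in>J \<rightarrow>\<^sub>E Q. \<Sum>k\<in>J. h (\<tau> k) * ?R \<tau> * of_bool (?B \<tau> k))"
    unfolding L_def by (rule sum.swap)
  also have "\<dots> = (\<Sum>\<tau>\<in>J \<rightarrow>\<^sub>E Q. ?R \<tau> * (\<Sum>k | k \<in> J \<and> ?B \<tau> k. h (\<tau> k)))"
    using \<open>finite J\<close>
    by (intro sum.cong refl) (auto simp: sum_distrib_left mult_ac of_bool_def sum.If_cases if_distrib Int_def cong: if_cong)
  also have "\<dots> \<le> (\<Sum>\<tau>\<in>J \<rightarrow>\<^sub>E Q. ?R \<tau> * (\<alpha> * (\<Sum>k\<in>J. h (\<tau> k))))"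
    using assms by (intro sum_mono mult_left_mono sum_above_quantile_le prod_nonneg) (auto simp: PiE_iff)
  also have "\<dots> = \<alpha> * (\<Sum>k\<in>J. U k)"
    unfolding U_def by (subst sum.swap) (simp add: sum_distrib_left mult_ac)
  also have "\<dots> = real (card J) * (\<alpha> * U i)" using swap by simp
  finally have "L i \<le> \<alpha> * U i"
    using \<open>finite J\<close> i by (subst (asm) mult_le_cancel_left_pos) (auto simp: card_gt_0_iff)
  then show ?thesis by (simp add: L_def U_def)
qed

section \<open>Exchangeable measures and orbits\<close>

text \<open>
  The possible values of \<open>\<sigma> 0, \<dots>, \<sigma> M\<close>. Keeping the fixed entry \<open>\<sigma> 0 = id\<close> in the tuple lets the data
  themselves be treated as one of the candidates \<open>z \<circ> w m\<close>.
\<close>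

definition id_tuples :: "nat \<Rightarrow> nat \<Rightarrow> (nat \<Rightarrow> nat \<Rightarrow> nat) set" where
  "id_tuples n M = {w \<in> {0..M} \<rightarrow>\<^sub>E perms n. w 0 = id}"

lemma finite_perms [simp]: "finite (perms n)"
  unfolding perms_def by (simp add: finite_permutations)

lemma id_in_perms [simp]: "id \<in> perms n"
  by (simp add: perms_def permutes_id)

lemma comp_in_perms: "\<pi> \<in> perms n \<Longrightarrow> \<rho> \<in> perms n \<Longrightarrow> \<pi> \<circ> \<rho> \<in> perms n"
  by (simp add: perms_def permutes_compose)

lemma inv_in_perms: "\<pi> \<in> perms n \<Longrightarrow> inv \<pi> \<in> perms n"
  by (simp add: perms_def permutes_inv)

lemma finite_id_tuples [simp]: "finite (id_tuples n M)"
  by (simp add: id_tuples_def finite_PiE)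

lemma sum_perms_translate:
  assumes "\<pi> \<in> perms n"
  shows "(\<Sum>\<rho>\<in>perms n. F (\<pi> \<circ> \<rho>)) = (\<Sum>\<rho>\<in>perms n. F \<rho>)"
proof (rule sum.reindex_bij_witness[where i = "\<lambda>\<rho>. inv \<pi> \<circ> \<rho>" and j = "\<lambda>\<rho>. \<pi> \<circ> \<rho>"])
  fix \<rho> assume "\<rho> \<in> perms n"
  with assms show "inv \<pi> \<circ> \<rho> \<in> perms n" "\<pi> \<circ> \<rho> \<in> perms n"
    by (auto intro: comp_in_perms inv_in_perms)
qed (use assms in \<open>auto simp: o_assoc perms_def permutes_inv_o\<close>)

text \<open>
  The group acts freely on tuples by left multiplication, and each orbit has exactly one
  member with \<open>id\<close> in position \<open>0\<close>.
\<close>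

lemma sum_PiE_perms_eq:
  "(\<Sum>\<tau>\<in>{0..M} \<rightarrow>\<^sub>E perms n. F \<tau>) =
   (\<Sum>\<pi>\<in>perms n. \<Sum>w\<in>id_tuples n M. F (\<lambda>m\<in>{0..M}. \<pi> \<circ> w m))"
proof -
  have inv: "inv \<pi> \<circ> \<pi> = id" "\<pi> \<circ> inv \<pi> = id" if "\<pi> \<in> perms n" for \<pi>
    using that by (auto simp: perms_def permutes_inv_o)
  have "(\<Sum>\<tau>\<in>{0..M} \<rightarrow>\<^sub>E perms n. F \<tau>) =
    (\<Sum>(\<pi>, w)\<in>perms n \<times> id_tuples n M. F (\<lambda>m\<in>{0..M}. \<pi> \<circ> w m))"
  proof (rule sum.reindex_bij_witness[where j = "\<lambda>\<tau>. (\<tau> 0, \<lambda>m\<in>{0..M}. inv (\<tau> 0) \<circ> \<tau> m)"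
        and i = "\<lambda>(\<pi>, w). \<lambda>m\<in>{0..M}. \<pi> \<circ> w m"], goal_cases)
    case (1 \<tau>)
    then have "\<tau> 0 \<in> perms n" by auto
    with 1 show ?case
      by (auto simp: fun_eq_iff o_assoc inv PiE_iff extensional_def permutes_inverses perms_def)
  next
    case (2 \<tau>)
    then have "\<tau> 0 \<in> perms n" by auto
    with 2 show ?case by (auto simp: id_tuples_def comp_in_perms inv_in_perms inv PiE_iff)
  next
    case (3 p)
    then obtain \<pi> w where p: "p = (\<pi>, w)" and \<pi>: "\<pi> \<in> perms n"
      and w: "w \<in> {0..M} \<rightarrow>\<^sub>E perms n" "w 0 = id"
      by (auto simp: id_tuples_def)
    let ?\<tau> = "\<lambda>m\<in>{0..M}. \<pi> \<circ> w m"
    have "?\<tau> 0 = \<pi>" using w(2) by simp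
    moreover have "(\<lambda>m\<in>{0..M}. inv \<pi> \<circ> ?\<tau> m) = w"
    proof
      fix m show "(\<lambda>m\<in>{0..M}. inv \<pi> \<circ> ?\<tau> m) m = w m"
        using PiE_arb[OF w(1), of m] by (simp add: o_assoc inv(1)[OF \<pi>])
    qed
    ultimately show ?case by (simp add: p)
  next
    case (4 p)
    then show ?case by (auto simp: id_tuples_def PiE_iff comp_in_perms)
  next
    case (5 \<tau>)
    then have "\<tau> 0 \<in> perms n" by auto
    with 5 have "(\<lambda>m\<in>{0..M}. \<tau> 0 \<circ> (\<lambda>m\<in>{0..M}. inv (\<tau> 0) \<circ> \<tau> m) m) = \<tau>"
      by (auto simp: fun_eq_iff o_assoc inv PiE_iff extensional_def permutes_inverses perms_def)
    then show ?case by simp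
  qed
  then show ?thesis by (simp add: sum.cartesian_product)
qed

lemma permute_measurable:
  assumes "sets \<mu> = sets (vec_space n A)" and "\<pi> \<in> perms n"
  shows "(\<lambda>v. v \<circ> \<pi>) \<in> measurable \<mu> \<mu>"
proof -
  have \<pi>: "\<pi> permutes {1..n + 1}" using assms(2) by (simp add: perms_def)
  have "(\<lambda>v. \<lambda>i\<in>{1..n + 1}. v (\<pi> i)) \<in> measurable (vec_space n A) (vec_space n A)"
    unfolding vec_space_def using permutes_in_image[OF \<pi>]
    by (intro measurable_restrict measurable_component_singleton) auto
  moreover have "(\<lambda>i\<in>{1..n + 1}. v (\<pi> i)) = v \<circ> \<pi>" if "v \<in> space (vec_space n A)" for v
    using that permutes_not_in[OF \<pi>]
    by (auto simp: fun_eq_iff vec_space_def space_PiM PiE_iff extensional_def)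
  ultimately have "(\<lambda>v. v \<circ> \<pi>) \<in> measurable (vec_space n A) (vec_space n A)"
    by (subst (asm) measurable_cong) auto
  then show ?thesis using assms(1) measurable_cong_sets by blast
qed

lemma nn_integral_permute:
  assumes "exchangeable_measure n A \<mu>" and "\<pi> \<in> perms n" and "F \<in> borel_measurable \<mu>"
  shows "(\<integral>\<^sup>+z. F (z \<circ> \<pi>) \<partial>\<mu>) = (\<integral>\<^sup>+z. F z \<partial>\<mu>)"
proof -
  have \<pi>: "(\<lambda>v. v \<circ> \<pi>) \<in> measurable \<mu> \<mu>" and eq: "distr \<mu> \<mu> (\<lambda>v. v \<circ> \<pi>) = \<mu>"
    using assms by (auto simp: exchangeable_measure_def intro: permute_measurable)
  have "(\<integral>\<^sup>+z. F z \<partial>distr \<mu> \<mu> (\<lambda>v. v \<circ> \<pi>)) = (\<integral>\<^sup>+z. F (z \<circ> \<pi>) \<partial>\<mu>)"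
    by (rule nn_integral_distr[OF \<pi>]) (simp add: assms(3))
  then show ?thesis by (simp add: eq)
qed

lemma AE_permute:
  assumes "exchangeable_measure n A \<mu>" and "AE z in \<mu>. Q z"
  shows "AE z in \<mu>. \<forall>\<pi>\<in>perms n. Q (z \<circ> \<pi>)"
proof (rule AE_finite_allI)
  fix \<pi> assume "\<pi> \<in> perms n"
  then have \<pi>: "(\<lambda>v. v \<circ> \<pi>) \<in> measurable \<mu> \<mu>" and "distr \<mu> \<mu> (\<lambda>v. v \<circ> \<pi>) = \<mu>"
    using assms by (auto simp: exchangeable_measure_def intro: permute_measurable)
  with assms(2) show "AE z in \<mu>. Q (z \<circ> \<pi>)" by (intro AE_distrD[OF \<pi>]) (simp only:)
qed simp

text \<open>
  If \<open>F z \<tau>\<close> depends on \<open>z\<close> and \<open>\<tau>\<close> only through the candidates \<open>z \<circ> \<tau> m\<close> (and the orbit of \<open>z\<close>), then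
  it is equivariant in the sense assumed here, and the invariance of \<open>\<mu>\<close> absorbs the first entry
  of \<open>\<tau>\<close> into \<open>z\<close>. This removes the special role of position \<open>0\<close>.
\<close>

lemma nn_integral_sum_PiE_perms:
  fixes F :: "(nat \<Rightarrow> 'a) \<Rightarrow> (nat \<Rightarrow> nat \<Rightarrow> nat) \<Rightarrow> ennreal"
  assumes ex: "exchangeable_measure n A \<mu>"
    and meas: "\<And>w. w \<in> {0..M} \<rightarrow>\<^sub>E perms n \<Longrightarrow> (\<lambda>z. F z w) \<in> borel_measurable \<mu>"
    and equivariant: "\<And>z \<pi> w. z \<in> space \<mu> \<Longrightarrow> \<pi> \<in> perms n \<Longrightarrow> w \<in> {0..M} \<rightarrow>\<^sub>E perms n \<Longrightarrow>
        F z (\<lambda>m\<in>{0..M}. \<pi> \<circ> w m) = F (z \<circ> \<pi>) w"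
  shows "(\<integral>\<^sup>+z. (\<Sum>\<tau>\<in>{0..M} \<rightarrow>\<^sub>E perms n. F z \<tau>) \<partial>\<mu>) =
    of_nat (card (perms n)) * (\<integral>\<^sup>+z. (\<Sum>w\<in>id_tuples n M. F z w) \<partial>\<mu>)"
proof -
  let ?G = "\<lambda>z. \<Sum>w\<in>id_tuples n M. F z w"
  have G: "?G \<in> borel_measurable \<mu>"
    by (intro borel_measurable_sum meas) (auto simp: id_tuples_def)
  have sets: "sets \<mu> = sets (vec_space n A)" using ex by (simp add: exchangeable_measure_def)
  have "(\<integral>\<^sup>+z. (\<Sum>\<tau>\<in>{0..M} \<rightarrow>\<^sub>E perms n. F z \<tau>) \<partial>\<mu>) = (\<integral>\<^sup>+z. (\<Sum>\<pi>\<in>perms n. ?G (z \<circ> \<pi>)) \<partial>\<mu>)"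
    unfolding sum_PiE_perms_eq
    by (intro nn_integral_cong sum.cong refl equivariant) (auto simp: id_tuples_def)
  also have "\<dots> = (\<Sum>\<pi>\<in>perms n. \<integral>\<^sup>+z. ?G (z \<circ> \<pi>) \<partial>\<mu>)"
    by (intro nn_integral_sum measurable_compose[OF permute_measurable[OF sets] G])
  also have "\<dots> = (\<Sum>\<pi>\<in>perms n. \<integral>\<^sup>+z. ?G z \<partial>\<mu>)"
    by (intro sum.cong refl nn_integral_permute[OF ex _ G])
  finally show ?thesis by simp
qed

section \<open>The joint law of the data and the sampled permutations\<close>

text \<open>
  The defining property of conditional expectation, integrated over the event \<open>Z \<in> A\<close> of the
  conditioning \<open>\<sigma>\<close>-algebra. The integrand on the right need not be measurable: it agrees almost
  everywhere with a conditional expectation, which is.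
\<close>

lemma cond_iid_given_emeasure:
  assumes "prob_space P" and Z: "Z \<in> measurable P N" and "finite J"
    and iid: "cond_iid_given P N Z S q J W" and w: "w \<in> J \<rightarrow> S" and A: "A \<in> sets N"
    and q: "\<And>z p. z \<in> space N \<Longrightarrow> p \<in> S \<Longrightarrow> 0 \<le> q z p"
  shows "{\<omega>\<in>space P. Z \<omega> \<in> A \<and> (\<forall>m\<in>J. W m \<omega> = w m)} \<in> sets P"
    and "emeasure P {\<omega>\<in>space P. Z \<omega> \<in> A \<and> (\<forall>m\<in>J. W m \<omega> = w m)} =
      (\<integral>\<^sup>+\<omega>. ennreal (\<Prod>m\<in>J. q (Z \<omega>) (w m)) * indicator A (Z \<omega>) \<partial>P)"
proof -
  interpret prob_space P by fact
  let ?F = "vimage_algebra (space P) Z N"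
  have "subalgebra P ?F"
    using Z by (auto simp: subalgebra_def sets_vimage_algebra2 measurable_space)
  then interpret finite_measure_subalgebra P ?F by unfold_locales
  let ?E = "{\<omega>\<in>space P. \<forall>m\<in>J. W m \<omega> = w m}"
  let ?A = "Z -` A \<inter> space P"
  let ?c = "real_cond_exp P ?F (indicator ?E)"
  have E: "?E \<in> sets P"
  proof (rule sets.sets_Collect_finite_All[OF _ \<open>finite J\<close>])
    fix m assume "m \<in> J"
    then have "W m \<in> measurable P (count_space S)" "w m \<in> S"
      using iid w by (auto simp: cond_iid_given_def)
    then have "W m -` {w m} \<inter> space P \<in> sets P" by (intro measurable_sets) auto
    then show "{\<omega>\<in>space P. W m \<omega> = w m} \<in> sets P" by (simp add: vimage_def Int_def conj_commute)
  qed
  have AF: "?A \<in> sets ?F" using Z A by (auto simp: sets_vimage_algebra2 measurable_space)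
  have AP: "?A \<in> sets P" using Z A by (rule measurable_sets)
  have eq: "{\<omega>\<in>space P. Z \<omega> \<in> A \<and> (\<forall>m\<in>J. W m \<omega> = w m)} = ?A \<inter> ?E" by auto
  show "{\<omega>\<in>space P. Z \<omega> \<in> A \<and> (\<forall>m\<in>J. W m \<omega> = w m)} \<in> sets P"
    unfolding eq using AP E by auto
  have int: "integrable P (indicator ?E :: _ \<Rightarrow> real)" using E by (simp add: emeasure_eq_measure)
  have c: "AE \<omega> in P. ?c \<omega> = (\<Prod>m\<in>J. q (Z \<omega>) (w m))"
    using iid w by (simp add: cond_iid_given_def)
  have nonneg: "0 \<le> (\<Prod>m\<in>J. q (Z \<omega>) (w m))" if "\<omega> \<in> space P" for \<omega>
    using that w q measurable_space[OF Z] by (intro prod_nonneg) auto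
  have cint: "integrable P (\<lambda>\<omega>. indicator ?A \<omega> * ?c \<omega>)"
    using integrable_real_mult_indicator[OF AP real_cond_exp_int(1)[OF int]] by (simp add: mult.commute)
  have "emeasure P (?A \<inter> ?E) = ennreal (\<integral>\<omega>. indicator ?A \<omega> * indicator ?E \<omega> \<partial>P)"
    using AP E by (simp add: emeasure_eq_measure indicator_inter_arith[symmetric])
  also have "(\<integral>\<omega>. indicator ?A \<omega> * indicator ?E \<omega> \<partial>P) = (\<integral>\<omega>. indicator ?A \<omega> * ?c \<omega> \<partial>P)"
    using real_cond_exp_intA[OF int AF] by (simp add: set_lebesgue_integral_def)
  also have "ennreal \<dots> = (\<integral>\<^sup>+\<omega>. ennreal (indicator ?A \<omega> * ?c \<omega>) \<partial>P)"
  proof (intro nn_integral_eq_integral[symmetric] cint)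
    show "AE \<omega> in P. 0 \<le> indicator ?A \<omega> * ?c \<omega>"
      using c AE_space by eventually_elim (simp add: nonneg)
  qed
  also have "\<dots> = (\<integral>\<^sup>+\<omega>. ennreal (\<Prod>m\<in>J. q (Z \<omega>) (w m)) * indicator A (Z \<omega>) \<partial>P)"
  proof (rule nn_integral_cong_AE)
    show "AE \<omega> in P. ennreal (indicator ?A \<omega> * ?c \<omega>) =
        ennreal (\<Prod>m\<in>J. q (Z \<omega>) (w m)) * indicator A (Z \<omega>)"
      using c AE_space by eventually_elim (simp add: indicator_def)
  qed
  finally show "emeasure P {\<omega>\<in>space P. Z \<omega> \<in> A \<and> (\<forall>m\<in>J. W m \<omega> = w m)} =
      (\<integral>\<^sup>+\<omega>. ennreal (\<Prod>m\<in>J. q (Z \<omega>) (w m)) * indicator A (Z \<omega>) \<partial>P)"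
    unfolding eq .
qed

lemma sampled_in_perms:
  fixes m :: nat
  assumes "cond_iid_given P N Z (perms n) q {1..M} \<sigma>"
    and "\<And>\<omega>. \<omega> \<in> space P \<Longrightarrow> \<sigma> 0 \<omega> = id"
    and "m \<in> {0..M}" "\<omega> \<in> space P"
  shows "\<sigma> m \<omega> \<in> perms n"
proof (cases "m = 0")
  case False
  with assms(3) have "m \<in> {1..M}" by auto
  with assms(1) have "\<sigma> m \<in> measurable P (count_space (perms n))"
    unfolding cond_iid_given_def by blast
  from measurable_space[OF this assms(4)] show ?thesis by simp
qed (use assms in simp)

text \<open>
  The joint law of \<open>Z\<close> and all the permutations: with respect to \<open>\<mu>\<close> and counting, it has density
  \<open>f z * (\<Prod>m\<in>{1..M}. q z (w m))\<close>. An arbitrary event about \<open>(Z, \<sigma>)\<close> is given by its sections \<open>B w\<close>.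
  Measurability is part of the conclusion because \<open>measure\<close> and \<open>emeasure\<close> are \<open>0\<close> on
  nonmeasurable sets, so that a lower bound on the probability of coverage depends on it.
\<close>

lemma emeasure_data_and_perms:
  assumes "prob_space P" and Z: "distributed P \<mu> Z f" and sets: "sets \<mu> = sets N"
    and id: "\<And>\<omega>. \<omega> \<in> space P \<Longrightarrow> \<sigma> 0 \<omega> = id"
    and iid: "cond_iid_given P N Z (perms n) q {1..M} \<sigma>"
    and q: "\<And>z \<rho>. z \<in> space N \<Longrightarrow> \<rho> \<in> perms n \<Longrightarrow> 0 \<le> q z \<rho>"
    and qm: "\<And>\<rho>. \<rho> \<in> perms n \<Longrightarrow> (\<lambda>z. q z \<rho>) \<in> borel_measurable \<mu>"
    and B: "\<And>w. w \<in> id_tuples n M \<Longrightarrow> B w \<in> sets \<mu>"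
  shows "{\<omega>\<in>space P. Z \<omega> \<in> B (\<lambda>m\<in>{0..M}. \<sigma> m \<omega>)} \<in> sets P" (is "?D \<in> _")
    and "emeasure P {\<omega>\<in>space P. Z \<omega> \<in> B (\<lambda>m\<in>{0..M}. \<sigma> m \<omega>)} =
      (\<integral>\<^sup>+z. (\<Sum>w\<in>id_tuples n M. f z * ennreal (\<Prod>m\<in>{1..M}. q z (w m)) * indicator (B w) z) \<partial>\<mu>)"
proof -
  interpret prob_space P by fact
  have ZN: "Z \<in> measurable P N"
    using distributed_measurable[OF Z] sets measurable_cong_sets by blast
  have f [measurable]: "f \<in> borel_measurable \<mu>"
    using Z by (rule distributed_borel_measurable)
  define D where "D w = {\<omega>\<in>space P. Z \<omega> \<in> B w \<and> (\<forall>m\<in>{1..M}. \<sigma> m \<omega> = w m)}" for w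
  have w: "w \<in> {1..M} \<rightarrow> perms n" "B w \<in> sets N" if "w \<in> id_tuples n M" for w
    using that B[OF that] sets by (auto simp: id_tuples_def)
  have D_sets: "D w \<in> sets P" if "w \<in> id_tuples n M" for w
    unfolding D_def using w[OF that] q
    by (intro cond_iid_given_emeasure(1)[OF \<open>prob_space P\<close> ZN _ iid]) auto
  note \<sigma> = sampled_in_perms[OF iid id]
  have w_eq: "(\<lambda>m\<in>{0..M}. \<sigma> m \<omega>) = w"
    if "w \<in> id_tuples n M" "\<omega> \<in> space P" "\<forall>m\<in>{1..M}. \<sigma> m \<omega> = w m" for w \<omega>
  proof
    fix m
    have PiE: "w \<in> {0..M} \<rightarrow>\<^sub>E perms n" and 0: "w 0 = id"
      using that(1) by (auto simp only: id_tuples_def mem_Collect_eq)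
    show "(\<lambda>m\<in>{0..M}. \<sigma> m \<omega>) m = w m"
    proof (cases "m = 0")
      case True
      then show ?thesis using id[OF that(2)] 0 by simp
    next
      case False
      then show ?thesis using that(3) PiE_arb[OF PiE, of m] by (cases "m \<le> M") simp_all
    qed
  qed
  have un: "?D = (\<Union>w\<in>id_tuples n M. D w)"
  proof (intro set_eqI iffI)
    fix \<omega> assume \<omega>: "\<omega> \<in> ?D"
    then have "(\<lambda>m\<in>{0..M}. \<sigma> m \<omega>) \<in> id_tuples n M"
      using \<sigma> id by (auto simp: id_tuples_def)
    with \<omega> show "\<omega> \<in> (\<Union>w\<in>id_tuples n M. D w)"
      by (intro UN_I[where a = "\<lambda>m\<in>{0..M}. \<sigma> m \<omega>"]) (auto simp: D_def)
  qed (auto simp: D_def w_eq)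
  show "?D \<in> sets P" unfolding un using D_sets by auto
  have disj: "disjoint_family_on D (id_tuples n M)"
    unfolding disjoint_family_on_def
  proof (intro ballI impI equals0I)
    fix w w' \<omega> assume "w \<in> id_tuples n M" "w' \<in> id_tuples n M" "w \<noteq> w'" "\<omega> \<in> D w \<inter> D w'"
    moreover from this have "\<omega> \<in> space P" "\<forall>m\<in>{1..M}. \<sigma> m \<omega> = w m" "\<forall>m\<in>{1..M}. \<sigma> m \<omega> = w' m"
      unfolding D_def by blast+
    ultimately show False using w_eq by metis
  qed
  have "emeasure P ?D = (\<Sum>w\<in>id_tuples n M. emeasure P (D w))"
    unfolding un using D_sets disj by (intro sum_emeasure[symmetric]) auto
  also have "\<dots> = (\<Sum>w\<in>id_tuples n M.
      \<integral>\<^sup>+z. f z * ennreal (\<Prod>m\<in>{1..M}. q z (w m)) * indicator (B w) z \<partial>\<mu>)"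
  proof (intro sum.cong refl)
    fix v assume v: "v \<in> id_tuples n M"
    have m [measurable]: "(\<lambda>z. q z (v m)) \<in> borel_measurable \<mu>" if "m \<in> {1..M}" for m
      using w(1)[OF v] that by (intro qm) auto
    have [measurable]: "B v \<in> sets \<mu>" using B v by simp
    have "emeasure P (D v) =
        (\<integral>\<^sup>+\<omega>. ennreal (\<Prod>m\<in>{1..M}. q (Z \<omega>) (v m)) * indicator (B v) (Z \<omega>) \<partial>P)"
      unfolding D_def using w[OF v] q
      by (intro cond_iid_given_emeasure(2)[OF \<open>prob_space P\<close> ZN _ iid]) auto
    also have "\<dots> = (\<integral>\<^sup>+z. f z * (ennreal (\<Prod>m\<in>{1..M}. q z (v m)) * indicator (B v) z) \<partial>\<mu>)"
      by (rule distributed_nn_integral[OF Z, symmetric]) measurable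
    finally show "emeasure P (D v) =
        (\<integral>\<^sup>+z. f z * ennreal (\<Prod>m\<in>{1..M}. q z (v m)) * indicator (B v) z \<partial>\<mu>)"
      by (simp add: mult.assoc)
  qed
  also have "\<dots> = (\<integral>\<^sup>+z. (\<Sum>w\<in>id_tuples n M.
      f z * ennreal (\<Prod>m\<in>{1..M}. q z (w m)) * indicator (B w) z) \<partial>\<mu>)"
  proof (intro nn_integral_sum[symmetric])
    fix v assume v: "v \<in> id_tuples n M"
    have m [measurable]: "(\<lambda>z. q z (v m)) \<in> borel_measurable \<mu>" if "m \<in> {1..M}" for m
      using w(1)[OF v] that by (intro qm) auto
    have [measurable]: "B v \<in> sets \<mu>" using B v by simp
    show "(\<lambda>z. f z * ennreal (\<Prod>m\<in>{1..M}. q z (v m)) * indicator (B v) z) \<in> borel_measurable \<mu>"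
      by measurable
  qed
  finally show "emeasure P ?D = \<dots>" .
qed

section \<open>Coverage\<close>

lemma proposal_prob_translate:
  assumes "\<pi> \<in> perms n"
  shows "proposal_prob n g (x \<circ> \<pi>) \<rho> = proposal_prob n g x (\<pi> \<circ> \<rho>)"
  using sum_perms_translate[OF assms, of "\<lambda>\<rho>. g (x \<circ> \<rho>)"]
  by (simp add: proposal_prob_def o_assoc)

text \<open>
  The bound on miscoverage for data in an arbitrary space. Here \<open>g\<close> is a function of the whole
  vector, because only its values on the orbit of \<open>z\<close> matter, and \<open>T\<close> is the score of a candidate.
  On the left is the mass of the tuples for which candidate \<open>0\<close>, that is \<open>z\<close> itself, lies
  above the weighted quantile.
\<close>

lemma nn_integral_above_quantile_le:
  fixes f g T :: "(nat \<Rightarrow> 'a) \<Rightarrow> real"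
  assumes ex: "exchangeable_measure n A \<mu>"
    and f: "f \<in> borel_measurable \<mu>" and f_nonneg: "\<And>z. z \<in> space \<mu> \<Longrightarrow> 0 \<le> f z"
    and g: "g \<in> borel_measurable \<mu>" and g_pos: "AE z in \<mu>. 0 < g z"
    and T: "T \<in> borel_measurable \<mu>" and "0 \<le> \<alpha>"
  defines "h \<equiv> \<lambda>z. f z / g z"
  shows "(\<integral>\<^sup>+z. (\<Sum>w\<in>id_tuples n M. ennreal (f z * (\<Prod>m\<in>{1..M}. proposal_prob n g z (w m)) *
             of_bool (above_quantile \<alpha> {0..M} (\<lambda>m. h (z \<circ> w m)) (\<lambda>m. T (z \<circ> w m)) 0))) \<partial>\<mu>)
    \<le> ennreal \<alpha> *
      (\<integral>\<^sup>+z. (\<Sum>w\<in>id_tuples n M. ennreal (f z * (\<Prod>m\<in>{1..M}. proposal_prob n g z (w m)))) \<partial>\<mu>)"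
proof -
  have sets: "sets \<mu> = sets (vec_space n A)" using ex by (simp add: exchangeable_measure_def)
  note permute = permute_measurable[OF sets]
  \<comment> \<open>\<open>f\<close> is taken at \<open>z \<circ> \<tau> 0\<close>, which is \<open>z\<close> on \<open>id_tuples\<close>, to make \<open>U\<close> equivariant on all tuples.\<close>
  define U where "U z \<tau> = f (z \<circ> \<tau> 0) * (\<Prod>m\<in>{1..M}. proposal_prob n g z (\<tau> m))"
    for z and \<tau> :: "nat \<Rightarrow> nat \<Rightarrow> nat"
  define E where "E z \<tau> \<longleftrightarrow> above_quantile \<alpha> {0..M} (\<lambda>m. h (z \<circ> \<tau> m)) (\<lambda>m. T (z \<circ> \<tau> m)) 0"
    for z and \<tau> :: "nat \<Rightarrow> nat \<Rightarrow> nat"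
  have h: "h \<in> borel_measurable \<mu>" unfolding h_def using f g by measurable
  have m: "(\<lambda>z. F (z \<circ> \<tau> m)) \<in> borel_measurable \<mu>"
    if "F \<in> borel_measurable \<mu>" "\<tau> \<in> {0..M} \<rightarrow>\<^sub>E perms n" "m \<in> {0..M}"
    for F :: "_ \<Rightarrow> real" and \<tau> m
    using that by (intro measurable_compose[OF permute]) auto
  have gm [measurable]: "(\<lambda>z. g (z \<circ> \<rho>)) \<in> borel_measurable \<mu>" if "\<rho> \<in> perms n" for \<rho>
    using that by (intro measurable_compose[OF permute g])
  have U: "(\<lambda>z. U z \<tau>) \<in> borel_measurable \<mu>" if \<tau>: "\<tau> \<in> {0..M} \<rightarrow>\<^sub>E perms n" for \<tau>
    unfolding U_def proposal_prob_def using \<tau>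
    by (intro borel_measurable_times borel_measurable_prod borel_measurable_divide
        borel_measurable_sum m[OF f] gm) auto
  have E: "{z\<in>space \<mu>. E z \<tau>} \<in> sets \<mu>" if \<tau>: "\<tau> \<in> {0..M} \<rightarrow>\<^sub>E perms n" for \<tau>
  proof -
    have [measurable]: "(\<lambda>z. h (z \<circ> \<tau> m)) \<in> borel_measurable \<mu>"
      "(\<lambda>z. T (z \<circ> \<tau> m)) \<in> borel_measurable \<mu>" if "m \<in> {0..M}" for m
      using m[OF h \<tau> that] m[OF T \<tau> that] by auto
    have "E z \<tau> \<longleftrightarrow> (1 - \<alpha>) * (\<Sum>j\<in>{0..M}. h (z \<circ> \<tau> j)) \<le>
      (\<Sum>j\<in>{0..M}. if T (z \<circ> \<tau> j) < T (z \<circ> \<tau> 0) then h (z \<circ> \<tau> j) else 0)" for z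
      unfolding E_def above_quantile_def by (simp only: sum.inter_filter finite_atLeastAtMost)
    then show ?thesis by simp
  qed
  have EU: "(\<lambda>z. U z \<tau> * of_bool (E z \<tau>)) \<in> borel_measurable \<mu>"
    if \<tau>: "\<tau> \<in> {0..M} \<rightarrow>\<^sub>E perms n" for \<tau>
  proof -
    have [measurable]: "{z\<in>space \<mu>. E z \<tau>} \<in> sets \<mu>" "(\<lambda>z. U z \<tau>) \<in> borel_measurable \<mu>"
      using E U \<tau> by auto
    have "(\<lambda>z. U z \<tau> * indicator {z\<in>space \<mu>. E z \<tau>} z) \<in> borel_measurable \<mu>" by measurable
    then show ?thesis by (subst (asm) measurable_cong) (auto simp: indicator_def)
  qed
  have U_eq: "U z (\<lambda>m\<in>{0..M}. \<pi> \<circ> \<tau> m) = U (z \<circ> \<pi>) \<tau>" if "\<pi> \<in> perms n" for z \<pi> \<tau>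
    using that by (auto simp: U_def proposal_prob_translate o_assoc intro!: prod.cong)
  have E_eq: "E z (\<lambda>m\<in>{0..M}. \<pi> \<circ> \<tau> m) \<longleftrightarrow> E (z \<circ> \<pi>) \<tau>" for z \<pi> \<tau>
    unfolding E_def by (intro above_quantile_cong) (auto simp: o_assoc)
  let ?N = "of_nat (card (perms n)) :: ennreal"
  let ?Q = "{0..M} \<rightarrow>\<^sub>E perms n"
  have "?N * (\<integral>\<^sup>+z. (\<Sum>w\<in>id_tuples n M. ennreal (U z w * of_bool (E z w))) \<partial>\<mu>)
    = (\<integral>\<^sup>+z. (\<Sum>\<tau>\<in>?Q. ennreal (U z \<tau> * of_bool (E z \<tau>))) \<partial>\<mu>)"
    using EU by (intro nn_integral_sum_PiE_perms[OF ex, symmetric]) (simp_all add: U_eq E_eq)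
  also have "\<dots> \<le> (\<integral>\<^sup>+z. ennreal \<alpha> * (\<Sum>\<tau>\<in>?Q. ennreal (U z \<tau>)) \<partial>\<mu>)"
  proof (rule nn_integral_mono_AE)
    show "AE z in \<mu>. (\<Sum>\<tau>\<in>?Q. ennreal (U z \<tau> * of_bool (E z \<tau>)))
      \<le> ennreal \<alpha> * (\<Sum>\<tau>\<in>?Q. ennreal (U z \<tau>))"
      using AE_permute[OF ex g_pos] AE_space
    proof eventually_elim
      case (elim z)
      then have g0: "0 < g (z \<circ> \<rho>)" and f0: "0 \<le> f (z \<circ> \<rho>)" if "\<rho> \<in> perms n" for \<rho>
        using that f_nonneg measurable_space[OF permute[OF that]] by auto
      let ?S = "\<Sum>\<rho>\<in>perms n. g (z \<circ> \<rho>)"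
      have S: "0 \<le> ?S" using g0 by (intro sum_nonneg) (auto intro: less_imp_le)
      \<comment> \<open>The factor \<open>g (z \<circ> \<tau> 0)\<close> of \<open>f (z \<circ> \<tau> 0)\<close> completes the product over the sampled candidates.\<close>
      have U: "U z \<tau> = h (z \<circ> \<tau> 0) * (\<Prod>m\<in>{0..M}. g (z \<circ> \<tau> m)) / ?S ^ M" if "\<tau> \<in> ?Q" for \<tau>
      proof -
        have "f (z \<circ> \<tau> 0) = h (z \<circ> \<tau> 0) * g (z \<circ> \<tau> 0)"
          using g0[OF PiE_mem[OF that, of 0]] by (simp add: h_def)
        moreover have "(\<Prod>m\<in>{0..M}. g (z \<circ> \<tau> m)) = g (z \<circ> \<tau> 0) * (\<Prod>m\<in>{1..M}. g (z \<circ> \<tau> m))"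
          by (simp add: prod.atLeast_Suc_atMost)
        ultimately show ?thesis by (simp add: U_def proposal_prob_def prod_dividef)
      qed
      have U0: "0 \<le> U z \<tau>" if "\<tau> \<in> ?Q" for \<tau>
        unfolding U[OF that] h_def
        using S g0[OF PiE_mem[OF that], THEN less_imp_le] f0[OF PiE_mem[OF that]]
        by (intro divide_nonneg_nonneg mult_nonneg_nonneg prod_nonneg) auto
      have "(\<Sum>\<tau>\<in>?Q. U z \<tau> * of_bool (E z \<tau>)) = (\<Sum>\<tau>\<in>?Q. h (z \<circ> \<tau> 0) *
          (\<Prod>m\<in>{0..M}. g (z \<circ> \<tau> m)) * of_bool (E z \<tau>)) / ?S ^ M"
        unfolding sum_divide_distrib by (intro sum.cong refl) (simp add: U)
      also have "\<dots> \<le> (\<alpha> * (\<Sum>\<tau>\<in>?Q. h (z \<circ> \<tau> 0) * (\<Prod>m\<in>{0..M}. g (z \<circ> \<tau> m)))) / ?S ^ M"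
        unfolding E_def using S g0 f0 \<open>0 \<le> \<alpha>\<close>
        by (intro divide_right_mono sum_PiE_above_quantile_le[of _ _ _ _ "\<lambda>\<rho>. h (z \<circ> \<rho>)" "\<lambda>\<rho>. g (z \<circ> \<rho>)"])
          (auto simp: h_def less_imp_le)
      also have "\<dots> = \<alpha> * (\<Sum>\<tau>\<in>?Q. U z \<tau>)"
        unfolding sum_divide_distrib sum_distrib_left by (intro sum.cong refl) (simp add: U)
      finally have "ennreal (\<Sum>\<tau>\<in>?Q. U z \<tau> * of_bool (E z \<tau>)) \<le> ennreal (\<alpha> * (\<Sum>\<tau>\<in>?Q. U z \<tau>))"
        by (rule ennreal_leI)
      moreover have "0 \<le> U z \<tau> * of_bool (E z \<tau>)" if "\<tau> \<in> ?Q" for \<tau>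
        using U0[OF that] by simp
      ultimately show ?case
        using U0 \<open>0 \<le> \<alpha>\<close> by (simp only: sum_ennreal ennreal_mult sum_nonneg)
    qed
  qed
  also have "\<dots> = ennreal \<alpha> * (\<integral>\<^sup>+z. (\<Sum>\<tau>\<in>?Q. ennreal (U z \<tau>)) \<partial>\<mu>)"
    using U by (intro nn_integral_cmult borel_measurable_sum) auto
  also have "(\<integral>\<^sup>+z. (\<Sum>\<tau>\<in>?Q. ennreal (U z \<tau>)) \<partial>\<mu>) = ?N * (\<integral>\<^sup>+z. (\<Sum>w\<in>id_tuples n M. ennreal (U z w)) \<partial>\<mu>)"
    using U by (intro nn_integral_sum_PiE_perms[OF ex]) (simp_all add: U_eq)
  finally have "?N * (\<integral>\<^sup>+z. (\<Sum>w\<in>id_tuples n M. ennreal (U z w * of_bool (E z w))) \<partial>\<mu>) \<le>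
      ?N * (ennreal \<alpha> * (\<integral>\<^sup>+z. (\<Sum>w\<in>id_tuples n M. ennreal (U z w)) \<partial>\<mu>))"
    by (simp add: mult.left_commute)
  moreover have "?N \<noteq> 0" using id_in_perms[of n] by (auto simp: card_eq_0_iff simp del: id_in_perms)
  ultimately have "(\<integral>\<^sup>+z. (\<Sum>w\<in>id_tuples n M. ennreal (U z w * of_bool (E z w))) \<partial>\<mu>) \<le>
      ennreal \<alpha> * (\<integral>\<^sup>+z. (\<Sum>w\<in>id_tuples n M. ennreal (U z w)) \<partial>\<mu>)"
    by (subst (asm) ennreal_mult_le_mult_iff) (auto simp: of_nat_less_top)
  moreover have "U z w = f z * (\<Prod>m\<in>{1..M}. proposal_prob n g z (w m))" if "w \<in> id_tuples n M" for z w
    using that by (simp add: U_def id_tuples_def)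
  ultimately show ?thesis by (simp add: E_def)
qed

lemma x_part_permute: "\<pi> \<in> perms n \<Longrightarrow> x_part n (z \<circ> \<pi>) = x_part n z \<circ> \<pi>"
  using permutes_in_image[of \<pi> "{1..n + 1}"] by (auto simp: x_part_def fun_eq_iff perms_def)

lemma x_part_measurable:
  "x_part n \<in> measurable (vec_space n (MX \<Otimes>\<^sub>M MY)) (vec_space n MX)"
  unfolding vec_space_def x_part_def by measurable

text \<open>
  Imputing the true response gives back the data, so that the score is a function of the
  candidate \<open>z \<circ> \<pi>\<close> alone.
\<close>

lemma perm_score_true_response:
  "perm_score n s z (snd (z (n + 1))) \<pi> = s ((z \<circ> \<pi>) (n + 1), z \<circ> \<pi>)"
  by (simp add: perm_score_def impute_def)

theorem theorem15:
  fixes P :: "'w measure" and MX :: "'x measure" and MY :: "'y measure"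
    and \<mu> :: "(nat \<Rightarrow> 'x \<times> 'y) measure" and \<mu>\<^sub>X :: "(nat \<Rightarrow> 'x) measure"
    and f :: "(nat \<Rightarrow> 'x \<times> 'y) \<Rightarrow> real" and f\<^sub>X g\<^sub>X :: "(nat \<Rightarrow> 'x) \<Rightarrow> real"
    and s :: "('x \<times> 'y) \<times> (nat \<Rightarrow> 'x \<times> 'y) \<Rightarrow> real"
    and Z :: "'w \<Rightarrow> nat \<Rightarrow> 'x \<times> 'y" and \<sigma> :: "nat \<Rightarrow> 'w \<Rightarrow> nat \<Rightarrow> nat"
    and n M :: nat and \<alpha> :: real
  assumes "prob_space P"
    and "n \<ge> 1" and "M \<ge> 1" and "\<alpha> \<in> {0..1}"
    and "exchangeable_measure n (MX \<Otimes>\<^sub>M MY) \<mu>" and "exchangeable_measure n MX \<mu>\<^sub>X"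
    and "distributed P \<mu> Z (\<lambda>z. ennreal (f z))" and "f \<in> borel_measurable \<mu>"
    and "\<forall>z\<in>space \<mu>. f z > 0"
    and "distributed P \<mu>\<^sub>X (\<lambda>\<omega>. x_part n (Z \<omega>)) (\<lambda>x. ennreal (f\<^sub>X x))"
    and "f\<^sub>X \<in> borel_measurable \<mu>\<^sub>X" and "\<forall>x\<in>space \<mu>\<^sub>X. f\<^sub>X x \<ge> 0"
    and "\<forall>z\<in>space \<mu>. \<forall>\<pi>\<in>perms n. f (z \<circ> \<pi>) / f z = f\<^sub>X (x_part n z \<circ> \<pi>) / f\<^sub>X (x_part n z)"
    and "g\<^sub>X \<in> borel_measurable \<mu>\<^sub>X" and "\<forall>x\<in>space \<mu>\<^sub>X. g\<^sub>X x \<ge> 0"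
    and "(\<integral>\<^sup>+x. ennreal (g\<^sub>X x) \<partial>\<mu>\<^sub>X) = 1"
    and "absolutely_continuous (density \<mu>\<^sub>X (\<lambda>x. ennreal (f\<^sub>X x))) (density \<mu>\<^sub>X (\<lambda>x. ennreal (g\<^sub>X x)))"
    and "absolutely_continuous (density \<mu>\<^sub>X (\<lambda>x. ennreal (g\<^sub>X x))) (density \<mu>\<^sub>X (\<lambda>x. ennreal (f\<^sub>X x)))"
    and "s \<in> borel_measurable ((MX \<Otimes>\<^sub>M MY) \<Otimes>\<^sub>M vec_space n (MX \<Otimes>\<^sub>M MY))"
    and "\<forall>\<omega>\<in>space P. \<sigma> 0 \<omega> = id"
    and "cond_iid_given P (vec_space n (MX \<Otimes>\<^sub>M MY)) Z (perms n)
           (\<lambda>z. proposal_prob n g\<^sub>X (x_part n z)) {1..M} \<sigma>"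
  shows "measure P {\<omega>\<in>space P. snd (Z \<omega> (n + 1)) \<in>
           prediction_set MY n s f\<^sub>X g\<^sub>X \<alpha> M (Z \<omega>) (\<lambda>m. \<sigma> m \<omega>)} \<ge> 1 - \<alpha>"
proof (cases "\<alpha> < 1")
  \<comment> \<open>At \<open>\<alpha> = 1\<close> the quantile is \<open>-\<infinity>\<close> and nothing is covered, but the bound is trivial.\<close>
  case False
  then have "1 - \<alpha> \<le> 0" by simp
  also have "0 \<le> measure P {\<omega>\<in>space P. snd (Z \<omega> (n + 1)) \<in>
           prediction_set MY n s f\<^sub>X g\<^sub>X \<alpha> M (Z \<omega>) (\<lambda>m. \<sigma> m \<omega>)}" by simp
  finally show ?thesis .
next
  case \<alpha>: True
  interpret prob_space P by fact
  let ?MZ = "vec_space n (MX \<Otimes>\<^sub>M MY)"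
  let ?x = "x_part n :: (nat \<Rightarrow> 'x \<times> 'y) \<Rightarrow> _"
  note ex = \<open>exchangeable_measure n (MX \<Otimes>\<^sub>M MY) \<mu>\<close> and Z = \<open>distributed P \<mu> Z (\<lambda>z. ennreal (f z))\<close>
    and X = \<open>distributed P \<mu>\<^sub>X (\<lambda>\<omega>. x_part n (Z \<omega>)) (\<lambda>x. ennreal (f\<^sub>X x))\<close>
  have sets: "sets \<mu> = sets ?MZ" and sets_X: "sets \<mu>\<^sub>X = sets (vec_space n MX)"
    using ex \<open>exchangeable_measure n MX \<mu>\<^sub>X\<close> by (auto simp: exchangeable_measure_def)
  have space: "space \<mu> = space ?MZ" by (rule sets_eq_imp_space_eq[OF sets])
  note permute = permute_measurable[OF sets]
  have x [measurable]: "?x \<in> measurable \<mu> \<mu>\<^sub>X"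
    using x_part_measurable measurable_cong_sets[OF sets sets_X] by blast
  define g where "g z = g\<^sub>X (?x z)" for z
  define T where "T z = s (z (n + 1), z)" for z
  define h where "h z = f z / g z" for z
  have f_pos: "0 < f z" if "z \<in> space \<mu>" for z
    using that \<open>\<forall>z\<in>space \<mu>. f z > 0\<close> by simp
  have g_nonneg: "0 \<le> g z" if "z \<in> space \<mu>" for z
    using measurable_space[OF x that] \<open>\<forall>x\<in>space \<mu>\<^sub>X. g\<^sub>X x \<ge> 0\<close> by (simp add: g_def)
  have g: "g \<in> borel_measurable \<mu>"
    unfolding g_def by (rule measurable_compose[OF x \<open>g\<^sub>X \<in> borel_measurable \<mu>\<^sub>X\<close>])
  have T: "T \<in> borel_measurable \<mu>"
  proof -
    have "(\<lambda>z. z (n + 1)) \<in> measurable ?MZ (MX \<Otimes>\<^sub>M MY)"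
      unfolding vec_space_def by (rule measurable_component_singleton) simp
    then have "(\<lambda>z. (z (n + 1), z)) \<in> measurable ?MZ ((MX \<Otimes>\<^sub>M MY) \<Otimes>\<^sub>M ?MZ)"
      by (intro measurable_Pair) auto
    then have "T \<in> borel_measurable ?MZ"
      unfolding T_def
      by (rule measurable_compose) (rule \<open>s \<in> borel_measurable ((MX \<Otimes>\<^sub>M MY) \<Otimes>\<^sub>M ?MZ)\<close>)
    then show ?thesis using measurable_cong_sets[OF sets refl] by blast
  qed
  have h: "h \<in> borel_measurable \<mu>"
    unfolding h_def by (intro borel_measurable_divide \<open>f \<in> borel_measurable \<mu>\<close> g)
  have h_nonneg: "0 \<le> h z" if "z \<in> space \<mu>" for z
    using f_pos[OF that] g_nonneg[OF that] by (simp add: h_def)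
  have permute_space: "z \<circ> \<rho> \<in> space \<mu>" if "z \<in> space \<mu>" "\<rho> \<in> perms n" for z \<rho>
    using measurable_space[OF permute[OF that(2)] that(1)] .
  \<comment> \<open>The zero set of \<open>g\<^sub>X\<close> is null for the law of the covariates by absolute continuity. As \<open>f > 0\<close>,
    the law of \<open>Z\<close> has the same null sets as \<open>\<mu>\<close>, so that \<open>g\<close> vanishes only on a \<open>\<mu>\<close>-null set.\<close>
  have g_pos: "AE z in \<mu>. 0 < g z"
  proof -
    let ?O = "{x\<in>space \<mu>\<^sub>X. g\<^sub>X x = 0}"
    have O: "?O \<in> sets \<mu>\<^sub>X" using \<open>g\<^sub>X \<in> borel_measurable \<mu>\<^sub>X\<close> by measurable
    have "?O \<in> null_sets (density \<mu>\<^sub>X (\<lambda>x. ennreal (g\<^sub>X x)))"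
      using O \<open>g\<^sub>X \<in> borel_measurable \<mu>\<^sub>X\<close> by (subst null_sets_density_iff) auto
    with \<open>absolutely_continuous (density \<mu>\<^sub>X (\<lambda>x. ennreal (g\<^sub>X x))) (density \<mu>\<^sub>X (\<lambda>x. ennreal (f\<^sub>X x)))\<close>
    have "?O \<in> null_sets (distr P \<mu>\<^sub>X (\<lambda>\<omega>. ?x (Z \<omega>)))"
      unfolding distributed_distr_eq_density[OF X] absolutely_continuous_def by blast
    then have "AE x in distr P \<mu>\<^sub>X (\<lambda>\<omega>. ?x (Z \<omega>)). x \<notin> ?O" by (rule AE_not_in)
    then have "AE \<omega> in P. ?x (Z \<omega>) \<notin> ?O"
      by (rule AE_distrD[OF distributed_measurable[OF X]])
    then have "AE z in distr P \<mu> Z. ?x z \<notin> ?O"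
      using O by (subst AE_distr_iff[OF distributed_measurable[OF Z]]) auto
    then have "AE z in \<mu>. 0 < ennreal (f z) \<longrightarrow> ?x z \<notin> ?O"
      unfolding distributed_distr_eq_density[OF Z]
      using \<open>f \<in> borel_measurable \<mu>\<close> by (subst (asm) AE_density) auto
    then show ?thesis
      using AE_space
    proof eventually_elim
      case (elim z)
      then have "g z \<noteq> 0" using f_pos measurable_space[OF x] by (auto simp: g_def)
      with g_nonneg[OF elim(2)] show ?case by simp
    qed
  qed
  \<comment> \<open>With \<open>x / 0 = 0\<close> this identity holds everywhere, also where \<open>g\<close> vanishes. Hence the miscoverage
    event below is described exactly and not only up to a null set.\<close>
  have weight: "importance_weight f\<^sub>X g\<^sub>X (?x z) \<rho> = h (z \<circ> \<rho>) / h z"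
    if "z \<in> space \<mu>" "\<rho> \<in> perms n" for z \<rho>
  proof -
    have "f\<^sub>X (?x z \<circ> \<rho>) / f\<^sub>X (?x z) = f (z \<circ> \<rho>) / f z"
      using that \<open>\<forall>z\<in>space \<mu>. \<forall>\<pi>\<in>perms n. f (z \<circ> \<pi>) / f z = f\<^sub>X (x_part n z \<circ> \<pi>) / f\<^sub>X (x_part n z)\<close>
      by simp
    then show ?thesis
      by (simp add: importance_weight_def h_def g_def x_part_permute[OF that(2)] divide_inverse mult_ac)
  qed
  have proposal: "proposal_prob n g\<^sub>X (?x z) \<rho> = proposal_prob n g z \<rho>" if "\<rho> \<in> perms n" for z \<rho>
    using that by (simp add: proposal_prob_def g_def x_part_permute)

  \<comment> \<open>The data for which the true response is not covered when the permutations are \<open>w\<close>.\<close>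
  define B where "B w = {z\<in>space \<mu>. 1 - \<alpha> \<le>
      (\<Sum>m | m \<in> {0..M} \<and> T (z \<circ> w m) < T z. h (z \<circ> w m) / h z) / (\<Sum>m\<in>{0..M}. h (z \<circ> w m) / h z)}"
    for w
  have B_sets: "B w \<in> sets \<mu>" if w: "w \<in> id_tuples n M" for w
  proof -
    have [measurable]: "(\<lambda>z. h (z \<circ> w m)) \<in> borel_measurable \<mu>"
      "(\<lambda>z. T (z \<circ> w m)) \<in> borel_measurable \<mu>" if "m \<in> {0..M}" for m
      using w that by (auto simp: id_tuples_def intro!: measurable_compose[OF permute] h T)
    note [measurable] = h T
    have "B w = {z\<in>space \<mu>. 1 - \<alpha> \<le>
      (\<Sum>m\<in>{0..M}. if T (z \<circ> w m) < T z then h (z \<circ> w m) / h z else 0) / (\<Sum>m\<in>{0..M}. h (z \<circ> w m) / h z)}"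
      unfolding B_def by (simp only: sum.inter_filter finite_atLeastAtMost)
    also have "\<dots> \<in> sets \<mu>" by measurable
    finally show ?thesis .
  qed
  have \<sigma>: "\<sigma> m \<omega> \<in> perms n" if "m \<in> {0..M}" "\<omega> \<in> space P" for m \<omega>
    using sampled_in_perms[OF \<open>cond_iid_given P ?MZ Z (perms n) (\<lambda>z. proposal_prob n g\<^sub>X (x_part n z)) {1..M} \<sigma>\<close>]
      \<open>\<forall>\<omega>\<in>space P. \<sigma> 0 \<omega> = id\<close> that by blast

  have miss: "snd (Z \<omega> (n + 1)) \<in> prediction_set MY n s f\<^sub>X g\<^sub>X \<alpha> M (Z \<omega>) (\<lambda>m. \<sigma> m \<omega>) \<longleftrightarrow>
      Z \<omega> \<notin> B (\<lambda>m\<in>{0..M}. \<sigma> m \<omega>)" if \<omega>: "\<omega> \<in> space P" for \<omega>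
  proof -
    let ?z = "Z \<omega>"
    let ?w = "\<lambda>m. importance_weight f\<^sub>X g\<^sub>X (?x ?z) (\<sigma> m \<omega>)"
    have z: "?z \<in> space \<mu>" using distributed_measurable[OF Z] \<omega> by (rule measurable_space)
    have "?z (n + 1) \<in> space (MX \<Otimes>\<^sub>M MY)"
      using z unfolding space by (auto simp: vec_space_def space_PiM PiE_iff)
    then have response: "snd (?z (n + 1)) \<in> space MY" by (auto simp: space_pair_measure)
    have w: "?w m = h (?z \<circ> \<sigma> m \<omega>) / h ?z" if "m \<in> {0..M}" for m
      using weight[OF z \<sigma>[OF that \<omega>]] .
    have w_nonneg: "0 \<le> ?w m" if "m \<in> {0..M}" for m
      unfolding w[OF that] using h_nonneg z permute_space[OF z \<sigma>[OF that \<omega>]] by simp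
    have score: "perm_score n s ?z (snd (?z (n + 1))) \<pi> = T (?z \<circ> \<pi>)" for \<pi>
      unfolding T_def by (rule perm_score_true_response)
    have "snd (?z (n + 1)) \<in> prediction_set MY n s f\<^sub>X g\<^sub>X \<alpha> M ?z (\<lambda>m. \<sigma> m \<omega>) \<longleftrightarrow>
      ereal (T (?z \<circ> id)) \<le> quantile (1 - \<alpha>) (weighted_dist {0..M} ?w (\<lambda>m. T (?z \<circ> \<sigma> m \<omega>)))"
      unfolding prediction_set_def mem_Collect_eq score using response by simp
    also have "\<dots> \<longleftrightarrow>
      (\<Sum>m | m \<in> {0..M} \<and> T (?z \<circ> \<sigma> m \<omega>) < T ?z. ?w m) / (\<Sum>m\<in>{0..M}. ?w m) < 1 - \<alpha>"
      using \<alpha> w_nonneg by (subst le_quantile_weighted_dist_iff) auto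
    also have "(\<Sum>m\<in>{0..M}. ?w m) = (\<Sum>m\<in>{0..M}. h (?z \<circ> \<sigma> m \<omega>) / h ?z)"
      by (rule sum.cong[OF refl w])
    also have "(\<Sum>m | m \<in> {0..M} \<and> T (?z \<circ> \<sigma> m \<omega>) < T ?z. ?w m) =
      (\<Sum>m | m \<in> {0..M} \<and> T (?z \<circ> \<sigma> m \<omega>) < T ?z. h (?z \<circ> \<sigma> m \<omega>) / h ?z)"
      by (rule sum.cong[OF refl]) (use w in blast)
    also have "(\<Sum>m\<in>{0..M}. h (?z \<circ> \<sigma> m \<omega>) / h ?z) =
      (\<Sum>m\<in>{0..M}. h (?z \<circ> (\<lambda>m\<in>{0..M}. \<sigma> m \<omega>) m) / h ?z)"
      by (rule sum.cong) auto
    also have "(\<Sum>m | m \<in> {0..M} \<and> T (?z \<circ> \<sigma> m \<omega>) < T ?z. h (?z \<circ> \<sigma> m \<omega>) / h ?z) =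
      (\<Sum>m | m \<in> {0..M} \<and> T (?z \<circ> (\<lambda>m\<in>{0..M}. \<sigma> m \<omega>) m) < T ?z.
        h (?z \<circ> (\<lambda>m\<in>{0..M}. \<sigma> m \<omega>) m) / h ?z)"
      by (rule sum.cong) auto
    finally show ?thesis using z unfolding B_def mem_Collect_eq not_le[symmetric] by simp
  qed

  let ?U = "\<lambda>z w. f z * (\<Prod>m\<in>{1..M}. proposal_prob n g z (w m))"
  let ?E = "\<lambda>z w. above_quantile \<alpha> {0..M} (\<lambda>m. h (z \<circ> w m)) (\<lambda>m. T (z \<circ> w m)) 0"
  have q_nonneg: "0 \<le> proposal_prob n g z \<rho>" if "z \<in> space \<mu>" "\<rho> \<in> perms n" for z \<rho>
    unfolding proposal_prob_def using that
    by (intro divide_nonneg_nonneg sum_nonneg g_nonneg permute_space)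
  have q_meas: "(\<lambda>z. proposal_prob n g\<^sub>X (?x z) \<rho>) \<in> borel_measurable \<mu>" if "\<rho> \<in> perms n" for \<rho>
    unfolding proposal[OF that] unfolding proposal_prob_def using that
    by (intro borel_measurable_divide borel_measurable_sum measurable_compose[OF permute g])
  have law: "{\<omega>\<in>space P. Z \<omega> \<in> C (\<lambda>m\<in>{0..M}. \<sigma> m \<omega>)} \<in> sets P"
    "emeasure P {\<omega>\<in>space P. Z \<omega> \<in> C (\<lambda>m\<in>{0..M}. \<sigma> m \<omega>)} =
      (\<integral>\<^sup>+z. (\<Sum>w\<in>id_tuples n M. ennreal (?U z w) * indicator (C w) z) \<partial>\<mu>)"
    if C: "\<And>w. w \<in> id_tuples n M \<Longrightarrow> C w \<in> sets \<mu>" for C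
  proof -
    note rules = emeasure_data_and_perms[OF \<open>prob_space P\<close> Z sets _
        \<open>cond_iid_given P ?MZ Z (perms n) (\<lambda>z. proposal_prob n g\<^sub>X (x_part n z)) {1..M} \<sigma>\<close> _ q_meas, of C]
    have q0: "0 \<le> proposal_prob n g\<^sub>X (?x z) \<rho>" if "z \<in> space ?MZ" "\<rho> \<in> perms n" for z \<rho>
      using q_nonneg that by (simp add: proposal space)
    show "{\<omega>\<in>space P. Z \<omega> \<in> C (\<lambda>m\<in>{0..M}. \<sigma> m \<omega>)} \<in> sets P"
      using \<open>\<forall>\<omega>\<in>space P. \<sigma> 0 \<omega> = id\<close> q0 C by (intro rules(1)) auto
    have "emeasure P {\<omega>\<in>space P. Z \<omega> \<in> C (\<lambda>m\<in>{0..M}. \<sigma> m \<omega>)} =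
      (\<integral>\<^sup>+z. (\<Sum>w\<in>id_tuples n M. ennreal (f z) *
        ennreal (\<Prod>m\<in>{1..M}. proposal_prob n g\<^sub>X (?x z) (w m)) * indicator (C w) z) \<partial>\<mu>)"
      using \<open>\<forall>\<omega>\<in>space P. \<sigma> 0 \<omega> = id\<close> q0 C by (intro rules(2)) auto
    also have "\<dots> = (\<integral>\<^sup>+z. (\<Sum>w\<in>id_tuples n M. ennreal (?U z w) * indicator (C w) z) \<partial>\<mu>)"
    proof (intro nn_integral_cong sum.cong refl arg_cong2[where f = "(*)"])
      fix z w assume "z \<in> space \<mu>" and w: "w \<in> id_tuples n M"
      have "w m \<in> perms n" if "m \<in> {1..M}" for m
        using w that by (auto simp: id_tuples_def)
      then have "(\<Prod>m\<in>{1..M}. proposal_prob n g\<^sub>X (?x z) (w m)) = (\<Prod>m\<in>{1..M}. proposal_prob n g z (w m))"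
        by (intro prod.cong refl proposal)
      then show "ennreal (f z) * ennreal (\<Prod>m\<in>{1..M}. proposal_prob n g\<^sub>X (?x z) (w m)) = ennreal (?U z w)"
        using f_pos[OF \<open>z \<in> space \<mu>\<close>] by (simp add: ennreal_mult')
    qed
    finally show "emeasure P {\<omega>\<in>space P. Z \<omega> \<in> C (\<lambda>m\<in>{0..M}. \<sigma> m \<omega>)} = \<dots>" .
  qed

  let ?miss = "{\<omega>\<in>space P. Z \<omega> \<in> B (\<lambda>m\<in>{0..M}. \<sigma> m \<omega>)}"
  have miss_sets: "?miss \<in> sets P" using B_sets by (rule law(1))
  have "emeasure P ?miss = (\<integral>\<^sup>+z. (\<Sum>w\<in>id_tuples n M. ennreal (?U z w) * indicator (B w) z) \<partial>\<mu>)"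
    using B_sets by (rule law(2))
  also have "\<dots> = (\<integral>\<^sup>+z. (\<Sum>w\<in>id_tuples n M. ennreal (?U z w * of_bool (?E z w))) \<partial>\<mu>)"
  proof (rule nn_integral_cong_AE)
    show "AE z in \<mu>. (\<Sum>w\<in>id_tuples n M. ennreal (?U z w) * indicator (B w) z) =
        (\<Sum>w\<in>id_tuples n M. ennreal (?U z w * of_bool (?E z w)))"
      using g_pos AE_space
    proof eventually_elim
      case (elim z)
      \<comment> \<open>Cancelling \<open>h z\<close> and clearing the denominator needs \<open>h z > 0\<close>, which makes the total weight positive.\<close>
      have hz: "0 < h z" using elim f_pos by (simp add: h_def)
      have "z \<in> B w \<longleftrightarrow> ?E z w" if w: "w \<in> id_tuples n M" for w
      proof -
        have w0: "z \<circ> w 0 = z" using w by (simp add: id_tuples_def)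
        have "h (z \<circ> w 0) \<le> (\<Sum>m\<in>{0..M}. h (z \<circ> w m))"
          using w elim by (intro member_le_sum h_nonneg permute_space) (auto simp: id_tuples_def)
        with hz w0 have "0 < (\<Sum>m\<in>{0..M}. h (z \<circ> w m))" by simp
        with hz elim w0 show ?thesis
          by (simp add: B_def above_quantile_def sum_divide_distrib[symmetric] le_divide_eq)
      qed
      then show ?case by (intro sum.cong refl) simp
    qed
  qed
  also have "\<dots> \<le> ennreal \<alpha> * (\<integral>\<^sup>+z. (\<Sum>w\<in>id_tuples n M. ennreal (?U z w)) \<partial>\<mu>)"
    unfolding h_def using \<open>\<alpha> \<in> {0..1}\<close> f_pos
    by (intro nn_integral_above_quantile_le[OF ex \<open>f \<in> borel_measurable \<mu>\<close> _ g g_pos T]) (auto intro: less_imp_le)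
  also have "(\<integral>\<^sup>+z. (\<Sum>w\<in>id_tuples n M. ennreal (?U z w)) \<partial>\<mu>) = 1"
  proof -
    have "(\<integral>\<^sup>+z. (\<Sum>w\<in>id_tuples n M. ennreal (?U z w)) \<partial>\<mu>) =
        emeasure P {\<omega>\<in>space P. Z \<omega> \<in> space \<mu>}"
      by (subst law(2)) (auto intro!: nn_integral_cong)
    also have "{\<omega>\<in>space P. Z \<omega> \<in> space \<mu>} = space P"
      using measurable_space[OF distributed_measurable[OF Z]] by auto
    finally show ?thesis by (simp add: emeasure_space_1)
  qed
  finally have "ennreal (prob ?miss) \<le> ennreal \<alpha>"
    unfolding emeasure_eq_measure mult_1_right .
  then have "prob ?miss \<le> \<alpha>"
    using \<open>\<alpha> \<in> {0..1}\<close> by (subst (asm) ennreal_le_iff) auto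
  then have "1 - \<alpha> \<le> prob (space P - ?miss)"
    unfolding prob_compl[OF miss_sets] by (rule diff_left_mono)
  also have "space P - ?miss = {\<omega>\<in>space P. snd (Z \<omega> (n + 1)) \<in>
           prediction_set MY n s f\<^sub>X g\<^sub>X \<alpha> M (Z \<omega>) (\<lambda>m. \<sigma> m \<omega>)}"
    using miss by auto
  finally show ?thesis .
qed

end
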